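(* The function $\mathrm{pdist}$ is a pseudometric on the set of all convex curves in the plane; that is, for all convex curves $C_1,C_2,C_3$ one has $\mathrm{pdist}(C_1,C_2)\ge 0$, $\mathrm{pdist}(C_1,C_1)=0$, $\mathrm{pdist}(C_1,C_2)=\mathrm{pdist}(C_2,C_1)$ and $\mathrm{pdist}(C_1,C_3)\le \mathrm{pdist}(C_1,C_2)+\mathrm{pdist}(C_2,C_3)$. Moreover, $\mathrm{pdist}$ is convex with respect to Minkowski addition: for all convex curves $C_1,C_2,D$ and every $t\in[0,1]$, $$\mathrm{pdist}(tC_1+(1-t)C_2,\,D)\le t\,\mathrm{pdist}(C_1,D)+(1-t)\,\mathrm{pdist}(C_2,D).$$ If equality holds for some $t\in(0,1)$, then $\ell_\theta(C_1)$ and $\ell_\theta(C_2)$ are on the same side of $\ell_\theta(D)$ (i.e. they do not lie in different open half-planes bounded by $\ell_\theta(D)$) for all $\theta\in[0,2\pi]$ for which these three normal lines are uniquely defined.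
   Context: A convex curve is the (closed) boundary curve of a planar convex body (compact convex set with nonempty interior); convex curves and convex bodies are used interchangeably. The Minkowski combination $tC_1+(1-t)C_2$ of convex curves is the boundary curve of the Minkowski combination of the corresponding convex bodies. Fix a unit vector $u_0$ in the plane; for $\theta\in[0,2\pi]$ let $u_\theta$ be the rotation of $u_0$ by angle $\theta$ counterclockwise. For a convex curve $C$ and each $\theta$ there is a unique supporting line to $C$ orthogonal to $u_\theta$ such that $C$ lies in the closed half-plane bounded by this line into which $u_\theta$ points. The normal line $\ell_\theta(C)$ is the line with direction $u_\theta$ through the common point of this supporting line and $C$. For each convex curve $C$ it is uniquely defined for all but countably many $\theta$ (for all $\theta$ if $C$ is strictly convex, i.e. has exactly one common point with each supporting line). For convex curves $C_1,C_2$, $$\mathrm{pdist}(C_1,C_2)=\frac12\int_0^{2\pi}\mathrm{dist}(\ell_\theta(C_1),\ell_\theta(C_2))\,d\theta,$$ where $\mathrm{dist}$ is the Euclidean distance between parallel lines. *)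

theory Defs
  imports "HOL-Analysis.Analysis"
begin

text \<open>
  The plane is the type \<^typ>\<open>complex\<close> with its Euclidean inner product and norm, so that
  counterclockwise rotation by \<open>\<theta>\<close> is multiplication by \<open>cis \<theta>\<close>.
\<close>

definition convex_body :: "complex set \<Rightarrow> bool" where
  "convex_body K \<longleftrightarrow> compact K \<and> convex K \<and> interior K \<noteq> {}"

definition convex_curve :: "complex set \<Rightarrow> bool" where
  "convex_curve C \<longleftrightarrow> (\<exists>K. convex_body K \<and> C = frontier K)"

definition curve_body :: "complex set \<Rightarrow> complex set" where
  "curve_body C = (THE K. convex_body K \<and> frontier K = C)"

definition minkowski_comb :: "real \<Rightarrow> complex set \<Rightarrow> complex set \<Rightarrow> complex set" where
  "minkowski_comb t C1 C2 =
     frontier {t *\<^sub>R x + (1 - t) *\<^sub>R y |x y. x \<in> curve_body C1 \<and> y \<in> curve_body C2}"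

text \<open>
  The supporting line of \<open>C\<close> orthogonal to \<open>u\<close>, with \<open>C\<close> on the side into which \<open>u\<close> points
  (so \<open>u\<close> is an inner normal).
\<close>

definition supporting_line :: "complex \<Rightarrow> complex set \<Rightarrow> complex set \<Rightarrow> bool" where
  "supporting_line u C L \<longleftrightarrow>
     (\<exists>c. L = {x. u \<bullet> x = c} \<and> C \<subseteq> {x. c \<le> u \<bullet> x} \<and> L \<inter> C \<noteq> {})"

definition is_normal_line :: "complex \<Rightarrow> complex set \<Rightarrow> complex set \<Rightarrow> bool" where
  "is_normal_line u C l \<longleftrightarrow>
     (\<exists>L p. supporting_line u C L \<and> p \<in> L \<inter> C \<and> l = {p + s *\<^sub>R u |s. s \<in> UNIV})"

definition normal_line_defined :: "complex \<Rightarrow> real \<Rightarrow> complex set \<Rightarrow> bool" where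
  "normal_line_defined u0 \<theta> C \<longleftrightarrow> (\<exists>!l. is_normal_line (cis \<theta> * u0) C l)"

text \<open>Meaningful only where \<^const>\<open>normal_line_defined\<close> holds, otherwise unspecified.\<close>

definition normal_line :: "complex \<Rightarrow> real \<Rightarrow> complex set \<Rightarrow> complex set" where
  "normal_line u0 \<theta> C = (THE l. is_normal_line (cis \<theta> * u0) C l)"

text \<open>
  For parallel lines \<^const>\<open>setdist\<close> is their Euclidean distance.  The countably many angles
  at which a normal line is not uniquely defined do not affect the integral.
\<close>

definition pdist :: "complex \<Rightarrow> complex set \<Rightarrow> complex set \<Rightarrow> real" where
  "pdist u0 C1 C2 =
     1 / 2 * integral {0..2 * pi} (\<lambda>\<theta>. setdist (normal_line u0 \<theta> C1) (normal_line u0 \<theta> C2))"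

definition separated_by_line :: "complex set \<Rightarrow> complex set \<Rightarrow> complex set \<Rightarrow> bool" where
  "separated_by_line l l1 l2 \<longleftrightarrow>
     (\<exists>a c. a \<noteq> 0 \<and> l = {x. a \<bullet> x = c} \<and> l1 \<subseteq> {x. a \<bullet> x < c} \<and> l2 \<subseteq> {x. c < a \<bullet> x})"

text \<open>Non-strict: \<open>l1\<close> or \<open>l2\<close> may coincide with \<open>l\<close>.\<close>

definition same_side :: "complex set \<Rightarrow> complex set \<Rightarrow> complex set \<Rightarrow> bool" where
  "same_side l l1 l2 \<longleftrightarrow> \<not> separated_by_line l l1 l2"

end

theory Submission
  imports Defs
begin

text \<open>
  Every normal line in direction \<open>u\<close> is a level set of the functional \<open>x \<mapsto> \<i>u \<bullet> x\<close>, so it is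
  recorded by one real number, its offset \<open>w(\<theta>)\<close>.  If points \<open>p\<close>, \<open>q\<close> of a compact set bounded
  by \<open>M\<close> are extremal at angles \<open>\<theta> < \<phi>\<close>, then their offsets satisfy
  \<open>w(\<phi>) \<le> w(\<theta>) + 2M(\<phi> - \<theta>)\<close>; so for any selection of extremal points \<open>2M\<theta> - w(\<theta>)\<close> is monotone,
  which makes the offset measurable and the normal line unique for all but countably many angles.
  Hence \<open>pdist\<close> is half the \<open>L\<^sup>1\<close> distance of offsets, and offsets are linear in Minkowski
  combinations.  In the equality case the nonnegative defect of the pointwise triangle inequality
  has integral zero; it is continuous wherever the three normal lines are unique, so it vanishes
  there.
\<close>

section \<open>Extremal points in a direction\<close>

definition face :: "'a::real_inner \<Rightarrow> 'a set \<Rightarrow> 'a set" where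
  "face u S = {p \<in> S. \<forall>x\<in>S. u \<bullet> p \<le> u \<bullet> x}"

text \<open>The choice operator makes this total: where several extremal points compete, one is
  picked arbitrarily, so every result about \<open>offset\<close> has to hold for any such
  selection.\<close>

definition offset :: "complex \<Rightarrow> complex set \<Rightarrow> real" where
  "offset u S = (\<i> * u) \<bullet> (SOME p. p \<in> face u S)"

lemma face_nonempty:
  assumes "compact S" "S \<noteq> {}"
  shows "face u S \<noteq> {}"
proof -
  have "continuous_on S (\<lambda>x. u \<bullet> x)" by (intro continuous_intros)
  then show ?thesis
    using continuous_attains_inf[OF assms, of "\<lambda>x. u \<bullet> x"] by (auto simp: face_def)
qed

lemma face_some:
  assumes "compact S" "S \<noteq> {}"
  shows "(SOME p. p \<in> face u S) \<in> face u S"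
  using face_nonempty[OF assms] by (simp add: some_in_eq)

lemma face_disjoint_interior:
  assumes "u \<noteq> 0"
  shows "face u S \<inter> interior S = {}"
proof (rule ccontr)
  assume "\<not> ?thesis"
  then obtain p where p: "p \<in> face u S" "p \<in> interior S" by auto
  obtain e where e: "e > 0" "cball p e \<subseteq> S" using p(2) by (auto simp: mem_interior_cball)
  define q where "q = p - (e / norm u) *\<^sub>R u"
  have "dist p q = e" using e assms by (simp add: q_def dist_norm)
  then have "q \<in> S" using e by auto
  then have "u \<bullet> p \<le> u \<bullet> q" using p(1) by (auto simp: face_def)
  moreover have "u \<bullet> q = u \<bullet> p - (e / norm u) * (u \<bullet> u)" by (simp add: q_def inner_diff_right)
  moreover have "(e / norm u) * (u \<bullet> u) > 0" using e assms by simp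
  ultimately show False by linarith
qed

text \<open>A minimizer of a nonzero linear functional cannot be interior, so the minimum over
  \<open>K\<close> is attained on the frontier, and both sets have the same minimum. Normal lines of
  a curve can thus be computed from its body.\<close>

lemma face_frontier:
  assumes "compact K" "K \<noteq> {}" "u \<noteq> 0"
  shows "face u (frontier K) = face u K"
proof
  have sub: "frontier K \<subseteq> K"
    using assms(1) compact_imp_closed frontier_subset_closed by blast
  have fr: "face u K \<subseteq> frontier K"
    using face_disjoint_interior[OF assms(3), of K] assms(1)
    by (auto simp: frontier_def face_def compact_imp_closed)
  show "face u K \<subseteq> face u (frontier K)"
    using fr sub by (auto simp: face_def)
  show "face u (frontier K) \<subseteq> face u K"
  proof
    fix p assume p: "p \<in> face u (frontier K)"
    obtain q where q: "q \<in> face u K" using face_nonempty[OF assms(1,2)] by auto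
    then have "u \<bullet> p \<le> u \<bullet> q" using p fr by (auto simp: face_def)
    then show "p \<in> face u K" using p q sub by (force simp: face_def)
  qed
qed

lemma face_minkowski:
  assumes "p \<in> face u A" "q \<in> face u B" "0 \<le> t" "t \<le> 1"
  shows "t *\<^sub>R p + (1 - t) *\<^sub>R q
    \<in> face u {t *\<^sub>R x + (1 - t) *\<^sub>R y |x y. x \<in> A \<and> y \<in> B}"
proof -
  have "u \<bullet> (t *\<^sub>R p + (1 - t) *\<^sub>R q) \<le> u \<bullet> (t *\<^sub>R x + (1 - t) *\<^sub>R y)"
    if "x \<in> A" "y \<in> B" for x y
    using assms that by (auto simp: face_def inner_add_right intro!: add_mono mult_left_mono)
  then show ?thesis using assms(1,2) unfolding face_def by blast
qed

section \<open>Normal lines as level sets\<close>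

lemma line_eq_level_set:
  fixes u p :: complex
  assumes "norm u = 1"
  shows "{p + s *\<^sub>R u |s. s \<in> UNIV} = {x. (\<i> * u) \<bullet> x = (\<i> * u) \<bullet> p}"
proof -
  have uu: "Re u * Re u + Im u * Im u = 1"
    using assms by (simp add: cmod_def power2_eq_square)
  \<comment> \<open>The vectors \<open>u\<close> and \<open>\<i> * u\<close> are orthonormal, so
    \<open>x - p\<close>, having no component along \<open>\<i> * u\<close>, equals its component
    along \<open>u\<close>; this is checked in coordinates.\<close>
  have "x = p + (u \<bullet> (x - p)) *\<^sub>R u" if "(\<i> * u) \<bullet> x = (\<i> * u) \<bullet> p" for x
  proof -
    define X Y where "X = Re x - Re p" and "Y = Im x - Im p"
    have h: "Im u * X = Re u * Y"
      using that by (simp add: inner_complex_def X_def Y_def algebra_simps)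
    have "(Re u * X + Im u * Y) * Re u = (Re u * Re u) * X + Im u * (Re u * Y)"
      by (simp add: algebra_simps)
    also have "\<dots> = (Re u * Re u + Im u * Im u) * X" unfolding h[symmetric] by (simp add: algebra_simps)
    finally have "X = (Re u * X + Im u * Y) * Re u" by (simp add: uu)
    moreover have "(Re u * X + Im u * Y) * Im u = Re u * (Im u * X) + (Im u * Im u) * Y"
      by (simp add: algebra_simps)
    then have "(Re u * X + Im u * Y) * Im u = (Re u * Re u + Im u * Im u) * Y"
      unfolding h by (simp add: algebra_simps)
    then have "Y = (Re u * X + Im u * Y) * Im u" by (simp add: uu)
    moreover have "u \<bullet> (x - p) = Re u * X + Im u * Y" by (simp add: inner_complex_def X_def Y_def)
    ultimately show ?thesis by (simp add: complex_eq_iff X_def Y_def)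
  qed
  moreover have "(\<i> * u) \<bullet> (p + s *\<^sub>R u) = (\<i> * u) \<bullet> p" for s
    by (simp add: inner_complex_def algebra_simps)
  ultimately show ?thesis by blast
qed

text \<open>A supporting line touching \<open>C\<close> at \<open>p\<close> must be the level of
  \<open>u\<close> through \<open>p\<close>, which says that \<open>p\<close> minimizes
  \<open>u\<close> on \<open>C\<close>.\<close>

lemma is_normal_line_iff:
  assumes "norm u = 1"
  shows "is_normal_line u C l \<longleftrightarrow> (\<exists>p\<in>face u C. l = {x. (\<i> * u) \<bullet> x = (\<i> * u) \<bullet> p})"
proof -
  have "(\<exists>L. supporting_line u C L \<and> p \<in> L \<inter> C) \<longleftrightarrow> p \<in> face u C" for p
  proof
    assume "p \<in> face u C"
    then have "supporting_line u C {x. u \<bullet> x = u \<bullet> p}" "p \<in> {x. u \<bullet> x = u \<bullet> p} \<inter> C"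
      unfolding supporting_line_def face_def by blast+
    then show "\<exists>L. supporting_line u C L \<and> p \<in> L \<inter> C" by blast
  qed (auto simp: supporting_line_def face_def)
  then show ?thesis
    unfolding is_normal_line_def line_eq_level_set[OF assms] by blast
qed

text \<open>Two level sets of the same functional coincide exactly when their levels do, so
  uniqueness of the line means that all extremal points share the offset of the chosen one.\<close>

lemma normal_line_defined_iff:
  assumes "norm u0 = 1" "compact C" "C \<noteq> {}"
  shows "normal_line_defined u0 \<theta> C \<longleftrightarrow>
    (\<forall>p\<in>face (cis \<theta> * u0) C. (\<i> * (cis \<theta> * u0)) \<bullet> p = offset (cis \<theta> * u0) C)"
proof -
  define u where "u = cis \<theta> * u0"
  have u: "norm u = 1" using assms by (simp add: u_def norm_mult)
  have s: "(SOME p. p \<in> face u C) \<in> face u C" by (rule face_some[OF assms(2,3)])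
  define L where "L p = {x. (\<i> * u) \<bullet> x = (\<i> * u) \<bullet> p}" for p
  have L: "L p = L q \<longleftrightarrow> (\<i> * u) \<bullet> p = (\<i> * u) \<bullet> q" for p q
    by (auto simp: L_def)
  have "normal_line_defined u0 \<theta> C \<longleftrightarrow> (\<exists>!l. \<exists>p\<in>face u C. l = L p)"
    unfolding normal_line_defined_def u_def[symmetric] is_normal_line_iff[OF u] L_def ..
  also have "\<dots> \<longleftrightarrow> (\<forall>p\<in>face u C. L p = L (SOME p. p \<in> face u C))"
  proof
    assume "\<exists>!l. \<exists>p\<in>face u C. l = L p"
    then show "\<forall>p\<in>face u C. L p = L (SOME p. p \<in> face u C)" using s by blast
  next
    assume "\<forall>p\<in>face u C. L p = L (SOME p. p \<in> face u C)"
    then have "l = L (SOME p. p \<in> face u C)" if "\<exists>p\<in>face u C. l = L p" for l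
      using that by metis
    then show "\<exists>!l. \<exists>p\<in>face u C. l = L p"
      using s by blast
  qed
  finally show ?thesis
    by (simp only: L offset_def u_def)
qed

lemma normal_line_eq:
  assumes "norm u0 = 1" "compact C" "C \<noteq> {}" "normal_line_defined u0 \<theta> C"
  shows "normal_line u0 \<theta> C = {x. (\<i> * (cis \<theta> * u0)) \<bullet> x = offset (cis \<theta> * u0) C}"
proof -
  have u: "norm (cis \<theta> * u0) = 1" using assms by (simp add: norm_mult)
  have "is_normal_line (cis \<theta> * u0) C {x. (\<i> * (cis \<theta> * u0)) \<bullet> x = offset (cis \<theta> * u0) C}"
    unfolding is_normal_line_iff[OF u] offset_def using face_some[OF assms(2,3)] by blast
  then show ?thesis
    using assms(4) unfolding normal_line_def normal_line_defined_def by (simp add: the1_equality)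
qed

text \<open>Two extremal points agree along \<open>u\<close> by minimality and along
  \<open>\<i> * u\<close> by uniqueness of the normal line, hence they are equal.\<close>

lemma face_singleton:
  assumes "norm u0 = 1" "compact C" "C \<noteq> {}" "normal_line_defined u0 \<theta> C"
  obtains p where "face (cis \<theta> * u0) C = {p}"
proof -
  define u where "u = cis \<theta> * u0"
  have u: "norm u = 1" using assms by (simp add: u_def norm_mult)
  obtain p where p: "p \<in> face u C" using face_nonempty[OF assms(2,3)] by auto
  have "q = p" if q: "q \<in> face u C" for q
  proof -
    have "(\<i> * u) \<bullet> q = (\<i> * u) \<bullet> p"
      using assms(4) p q unfolding normal_line_defined_iff[OF assms(1-3)] u_def by simp
    then have "q \<in> {p + s *\<^sub>R u |s. s \<in> UNIV}" unfolding line_eq_level_set[OF u] by simp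
    then obtain s where s: "q = p + s *\<^sub>R u" by auto
    have "u \<bullet> q = u \<bullet> p" using p q by (auto simp: face_def intro: antisym)
    then have "s * (u \<bullet> u) = 0" by (simp add: s inner_add_right)
    then show ?thesis using u s by auto
  qed
  then show ?thesis using p that unfolding u_def by blast
qed

lemma setdist_parallel_lines:
  fixes v :: "'a::euclidean_space"
  assumes "norm v = 1"
  shows "setdist {x. v \<bullet> x = a} {x. v \<bullet> x = b} = \<bar>a - b\<bar>"
proof -
  have vv: "v \<bullet> v = 1" using assms by (simp add: norm_eq_1)
  have d: "dist (a *\<^sub>R v) (b *\<^sub>R v) = \<bar>a - b\<bar>"
    using assms by (simp add: dist_norm flip: scaleR_left_diff_distrib)
  have "setdist {x. v \<bullet> x = a} {x. v \<bullet> x = b} = dist (a *\<^sub>R v) (b *\<^sub>R v)"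
  proof (rule setdist_unique)
    fix x y assume "x \<in> {x. v \<bullet> x = a} \<and> y \<in> {x. v \<bullet> x = b}"
    then have "a - b = v \<bullet> (x - y)" by (simp add: inner_diff_right)
    then show "dist (a *\<^sub>R v) (b *\<^sub>R v) \<le> dist x y"
      using Cauchy_Schwarz_ineq2[of v "x - y"] assms d by (simp add: dist_norm)
  qed (use vv in auto)
  with d show ?thesis by simp
qed

section \<open>Dependence of the offset on the angle\<close>

text \<open>Passing from \<open>p\<close> to \<open>q\<close> can only lower the offset in the
  rotated frame; what remains is the effect of rotating the frame at the fixed point
  \<open>p\<close>, which is at most \<open>2 * M\<close> times the angle. Both points are arbitrary
  extremal points, which the uniqueness argument below relies on.\<close>

lemma face_offset_step:
  assumes "norm u0 = 1" "\<And>x. x \<in> S \<Longrightarrow> norm x \<le> M" "\<theta> < \<phi>" "\<phi> < \<theta> + 1"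
    and p: "p \<in> face (cis \<theta> * u0) S" and q: "q \<in> face (cis \<phi> * u0) S"
  shows "(\<i> * (cis \<phi> * u0)) \<bullet> q \<le> (\<i> * (cis \<theta> * u0)) \<bullet> p + 2 * M * (\<phi> - \<theta>)"
proof -
  define d where "d = \<phi> - \<theta>"
  define u where "u = cis \<theta> * u0"
  define v where "v = \<i> * u"
  have d: "0 < d" "d < 1" using assms by (auto simp: d_def)
  have u: "norm u = 1" and v: "norm v = 1" using assms by (auto simp: u_def v_def norm_mult)
  have "cis \<phi> * u0 = cis d * u" by (simp add: d_def u_def cis_mult flip: mult.assoc)
  then have u': "cis \<phi> * u0 = cos d *\<^sub>R u + sin d *\<^sub>R v"
    by (simp add: v_def complex_eq_iff algebra_simps)
  have v': "\<i> * (cis \<phi> * u0) = cos d *\<^sub>R v - sin d *\<^sub>R u"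
    unfolding u' by (simp add: v_def complex_eq_iff)
  have cd: "cos d > 0" "sin d > 0"
    using d pi_gt3 by (auto intro!: cos_gt_zero_pi sin_gt_zero)
  have mem: "p \<in> S" "q \<in> S" using p q by (auto simp: face_def)
  \<comment> \<open>Extremality of \<open>p\<close> at the first angle and of \<open>q\<close> at
    the second together determine the signs of both components of \<open>q - p\<close>.\<close>
  have a: "u \<bullet> (q - p) \<ge> 0" using p mem by (auto simp: face_def u_def inner_diff_right)
  have "(cis \<phi> * u0) \<bullet> (q - p) \<le> 0" using q mem by (auto simp: face_def inner_diff_right)
  then have "cos d * (u \<bullet> (q - p)) + sin d * (v \<bullet> (q - p)) \<le> 0"
    unfolding u' by (simp add: inner_add_left)
  moreover have ca: "cos d * (u \<bullet> (q - p)) \<ge> 0" using a cd by simp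
  ultimately have "sin d * (v \<bullet> (q - p)) \<le> 0" by linarith
  then have b: "v \<bullet> (q - p) \<le> 0" using cd by (simp add: mult_le_0_iff)
  have 1: "cos d * (v \<bullet> (q - p)) \<le> 0" "sin d * (u \<bullet> (q - p)) \<ge> 0"
    using a b cd by (auto simp: mult_le_0_iff)
  have M: "norm p \<le> M" using assms(2) mem by blast
  have vp: "\<bar>v \<bullet> p\<bar> \<le> M" "\<bar>u \<bullet> p\<bar> \<le> M"
    using Cauchy_Schwarz_ineq2[of v p] Cauchy_Schwarz_ineq2[of u p] M u v by auto
  have M0: "0 \<le> M" using M norm_ge_zero order_trans by blast
  have "sin d \<le> d" using d by (intro sin_x_le_x) auto
  moreover have "1 - cos d \<le> d"
  proof -
    \<comment> \<open>Half-angle formula: 1 - cos d = 2 sin^2(d/2), which is at most d^2/2.\<close>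
    have "sin (d/2) ^ 2 \<le> (d/2) ^ 2"
      using d by (intro power_mono sin_x_le_x sin_ge_zero) (use pi_gt3 in auto)
    then have "1 - cos d \<le> d\<^sup>2 / 2" using cos_double_sin[of "d/2"] by (simp add: power_divide)
    also have "\<dots> \<le> d" using d mult_left_le[of d d] by (simp add: power2_eq_square)
    finally show ?thesis .
  qed
  ultimately have 2: "\<bar>(cos d - 1) * (v \<bullet> p)\<bar> \<le> d * M" "\<bar>sin d * (u \<bullet> p)\<bar> \<le> d * M"
    unfolding abs_mult using vp M0 d cd by (auto intro!: mult_mono)
  \<comment> \<open>The second and third summands come from rotating the frame at \<open>p\<close>
    and contribute at most \<open>d * M\<close> each; the last two come from moving to
    \<open>q\<close> and are nonpositive.\<close>
  have "(\<i> * (cis \<phi> * u0)) \<bullet> q = v \<bullet> p + (cos d - 1) * (v \<bullet> p) - sin d * (u \<bullet> p)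
      + cos d * (v \<bullet> (q - p)) - sin d * (u \<bullet> (q - p))"
    unfolding v' by (simp add: inner_diff_left inner_diff_right algebra_simps)
  then show ?thesis
    using 1 2 unfolding d_def[symmetric] u_def[symmetric] v_def[symmetric]
    by (simp add: algebra_simps)
qed

lemma mono_if_locally_mono:
  fixes f :: "real \<Rightarrow> real"
  assumes "\<And>x y. x < y \<Longrightarrow> y < x + 1 \<Longrightarrow> f x \<le> f y"
  shows "mono f"
proof -
  \<comment> \<open>Induction on the number of half-unit steps; each step is shorter than 1, so the
    local hypothesis applies to it.\<close>
  have "f x \<le> f y" if "x \<le> y" "y < x + real n / 2" for n x y
    using that
  proof (induction n arbitrary: y)
    case (Suc n)
    show ?case
    proof (cases "y < x + 1")
      case True
      then show ?thesis using assms[of x y] Suc.prems by (cases "x = y") auto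
    next
      case False
      then have "f x \<le> f (y - 1/2)" using Suc by (simp add: field_simps)
      also have "\<dots> \<le> f y" by (rule assms) auto
      finally show ?thesis .
    qed
  qed auto
  moreover have "\<exists>n. y < x + real n / 2" for x y :: real
    using reals_Archimedean2[of "2 * (y - x)"] by (auto simp: field_simps)
  ultimately show ?thesis by (meson monoI)
qed

lemma mono_offset:
  assumes "norm u0 = 1" "compact S" "S \<noteq> {}" "\<And>x. x \<in> S \<Longrightarrow> norm x \<le> M"
  shows "mono (\<lambda>\<theta>. 2 * M * \<theta> - offset (cis \<theta> * u0) S)"
proof (rule mono_if_locally_mono)
  fix x y :: real assume "x < y" "y < x + 1"
  from face_offset_step[OF assms(1,4) this face_some[OF assms(2,3)] face_some[OF assms(2,3)]]
  show "2 * M * x - offset (cis x * u0) S \<le> 2 * M * y - offset (cis y * u0) S"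
    by (simp add: offset_def algebra_simps)
qed

lemma compact_norm_bound:
  fixes S :: "complex set"
  assumes "compact S"
  obtains M where "\<And>x. x \<in> S \<Longrightarrow> norm x \<le> M"
  using compact_imp_bounded[OF assms] unfolding bounded_iff by blast

text \<open>An arbitrary extremal point at the given angle is compared with the chosen ones at
  nearby angles. Angles on the right bound its offset from below, angles on the left from above, and
  by continuity both bounds tend to the chosen offset.\<close>

lemma normal_line_defined_if_isCont:
  assumes "norm u0 = 1" "compact S" "S \<noteq> {}"
    and cont: "isCont (\<lambda>\<theta>. offset (cis \<theta> * u0) S) \<theta>"
  shows "normal_line_defined u0 \<theta> S"
  unfolding normal_line_defined_iff[OF assms(1-3)]
proof
  define w where "w \<phi> = offset (cis \<phi> * u0) S" for \<phi>
  fix p assume p: "p \<in> face (cis \<theta> * u0) S"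
  obtain M where M: "\<And>x. x \<in> S \<Longrightarrow> norm x \<le> M" using compact_norm_bound[OF assms(2)] by blast
  define a where "a = (\<i> * (cis \<theta> * u0)) \<bullet> p"
  have w: "(w \<longlongrightarrow> w \<theta>) (at \<theta>)" using cont by (simp add: isCont_def w_def[abs_def])
  have R: "((\<lambda>\<phi>. w \<phi> - 2 * M * (\<phi> - \<theta>)) \<longlongrightarrow> w \<theta> - 2 * M * (\<theta> - \<theta>)) (at_right \<theta>)"
    and L: "((\<lambda>\<phi>. w \<phi> - 2 * M * (\<phi> - \<theta>)) \<longlongrightarrow> w \<theta> - 2 * M * (\<theta> - \<theta>)) (at_left \<theta>)"
    by (intro tendsto_intros Lim_at_imp_Lim_at_within[OF w])+
  have "w \<theta> - 2 * M * (\<theta> - \<theta>) \<le> a"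
  proof (rule tendsto_upperbound[OF R])
    have "w \<phi> - 2 * M * (\<phi> - \<theta>) \<le> a" if "\<theta> < \<phi>" "\<phi> < \<theta> + 1" for \<phi>
      using face_offset_step[OF assms(1) M that p face_some[OF assms(2,3)]]
      by (simp add: w_def offset_def a_def)
    then show "\<forall>\<^sub>F \<phi> in at_right \<theta>. w \<phi> - 2 * M * (\<phi> - \<theta>) \<le> a"
      by (intro eventually_mono[OF eventually_at_right_real[of \<theta> "\<theta> + 1"]]) auto
  qed simp
  moreover have "a \<le> w \<theta> - 2 * M * (\<theta> - \<theta>)"
  proof (rule tendsto_lowerbound[OF L])
    have "a \<le> w \<phi> - 2 * M * (\<phi> - \<theta>)" if "\<phi> < \<theta>" "\<theta> < \<phi> + 1" for \<phi>
      using face_offset_step[OF assms(1) M that face_some[OF assms(2,3)] p]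
      by (simp add: w_def offset_def a_def algebra_simps)
    then show "\<forall>\<^sub>F \<phi> in at_left \<theta>. a \<le> w \<phi> - 2 * M * (\<phi> - \<theta>)"
      by (intro eventually_mono[OF eventually_at_left_real[of "\<theta> - 1" \<theta>]]) auto
  qed simp
  ultimately show "(\<i> * (cis \<theta> * u0)) \<bullet> p = offset (cis \<theta> * u0) S"
    by (simp add: a_def w_def)
qed

text \<open>A monotone function has only countably many discontinuities, and adding a linear term
  does not change where they lie.\<close>

lemma countable_not_normal_line_defined:
  assumes "norm u0 = 1" "compact S" "S \<noteq> {}"
  shows "countable {\<theta>. \<not> normal_line_defined u0 \<theta> S}"
proof -
  obtain M where M: "\<And>x. x \<in> S \<Longrightarrow> norm x \<le> M" using compact_norm_bound[OF assms(2)] by blast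
  define g where "g = (\<lambda>\<theta>. 2 * M * \<theta> - offset (cis \<theta> * u0) S)"
  have "mono g" unfolding g_def by (rule mono_offset[OF assms M])
  then have c: "countable {a. \<not> isCont g a}" by (rule mono_ctble_discont)
  have "isCont (\<lambda>\<theta>. offset (cis \<theta> * u0) S) a" if "isCont g a" for a
  proof -
    have "isCont (\<lambda>\<theta>. 2 * M * \<theta> - g \<theta>) a" using that by (intro continuous_intros)
    then show ?thesis by (simp add: g_def)
  qed
  then have "{\<theta>. \<not> normal_line_defined u0 \<theta> S} \<subseteq> {a. \<not> isCont g a}"
    using normal_line_defined_if_isCont[OF assms] by blast
  then show ?thesis using c countable_subset by blast
qed

text \<open>Converse of \<open>normal_line_defined_if_isCont\<close>, needed for the equality case:
  if the extremal point \<open>p\<close> is unique, then by compactness the extremal points chosen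
  at nearby angles converge to it.\<close>

lemma isCont_offset:
  assumes "norm u0 = 1" "compact S" "S \<noteq> {}" "normal_line_defined u0 \<theta> S"
  shows "isCont (\<lambda>\<phi>. offset (cis \<phi> * u0) S) \<theta>"
proof -
  define P where "P \<phi> = (SOME p. p \<in> face (cis \<phi> * u0) S)" for \<phi>
  have P: "P \<phi> \<in> face (cis \<phi> * u0) S" for \<phi>
    unfolding P_def by (rule face_some[OF assms(2,3)])
  obtain M where M: "\<And>x. x \<in> S \<Longrightarrow> norm x \<le> M" using compact_norm_bound[OF assms(2)] by blast
  define u where "u = cis \<theta> * u0"
  obtain p where p: "face u S = {p}" unfolding u_def by (rule face_singleton[OF assms])
  have pS: "p \<in> S" using p by (auto simp: face_def)
  have lim: "((\<lambda>\<phi>. norm (cis \<phi> * u0 - u) * (2 * M)) \<longlongrightarrow> norm (cis \<theta> * u0 - u) * (2 * M)) (at \<theta>)"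
    by (intro tendsto_intros)
  have "(P \<longlongrightarrow> p) (at \<theta>)"
  proof (rule tendstoI)
    fix e :: real assume "e > 0"
    define T where "T = S - ball p e"
    have T: "compact T" using assms(2) unfolding T_def by (rule compact_diff) simp
    show "\<forall>\<^sub>F \<phi> in at \<theta>. dist (P \<phi>) p < e"
    proof (cases "T = {}")
      case True
      have "P \<phi> \<in> ball p e" for \<phi> using P[of \<phi>] True by (auto simp: face_def T_def)
      then have "dist (P \<phi>) p < e" for \<phi> by (simp add: dist_commute)
      then show ?thesis by simp
    next
      case False
      obtain m where m: "m \<in> face u T" using face_nonempty[OF T False] by auto
      \<comment> \<open>The gap by which every point of \<open>S\<close> at distance at least
        \<open>e\<close> from \<open>p\<close> misses the minimum of \<open>u\<close>. It is
        positive because \<open>p\<close> is the only minimizer.\<close>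
      define r where "r = u \<bullet> m - u \<bullet> p"
      have pmin: "u \<bullet> p \<le> u \<bullet> x" if "x \<in> S" for x using p that by (auto simp: face_def)
      have "m \<in> S" "m \<noteq> p" using m \<open>e > 0\<close> by (auto simp: face_def T_def)
      then have "m \<notin> face u S" using p by auto
      then obtain x where "x \<in> S" "u \<bullet> x < u \<bullet> m"
        using \<open>m \<in> S\<close> by (auto simp: face_def not_le)
      then have "r > 0" using pmin[of x] by (simp add: r_def)
      then have "\<forall>\<^sub>F \<phi> in at \<theta>. norm (cis \<phi> * u0 - u) * (2 * M) < r"
        by (intro order_tendstoD(2)[OF lim]) (simp add: u_def)
      then show ?thesis
      proof (rule eventually_mono)
        fix \<phi> assume h: "norm (cis \<phi> * u0 - u) * (2 * M) < r"
        show "dist (P \<phi>) p < e"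
        proof (rule ccontr)
          assume "\<not> ?thesis"
          then have PT: "P \<phi> \<in> T" using P[of \<phi>] by (auto simp: T_def face_def dist_commute)
          then have "u \<bullet> (P \<phi> - p) \<ge> r" using m by (auto simp: face_def r_def inner_diff_right)
          moreover have "(cis \<phi> * u0) \<bullet> (P \<phi> - p) \<le> 0"
            using P[of \<phi>] pS by (auto simp: face_def inner_diff_right)
          \<comment> \<open>A distant \<open>P \<phi>\<close> could be extremal only if turning the
            direction made up for the whole gap \<open>r\<close>, but by Cauchy-Schwarz a small turn
            gains too little.\<close>
          ultimately have "r \<le> (u - cis \<phi> * u0) \<bullet> (P \<phi> - p)" by (simp add: inner_diff_left)
          also have "\<dots> \<le> norm (cis \<phi> * u0 - u) * norm (P \<phi> - p)"
            using norm_cauchy_schwarz[of "u - cis \<phi> * u0" "P \<phi> - p"]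
            by (simp add: norm_minus_commute)
          also have "\<dots> \<le> norm (cis \<phi> * u0 - u) * (2 * M)"
          proof (rule mult_left_mono)
            show "norm (P \<phi> - p) \<le> 2 * M"
              using norm_triangle_ineq4[of "P \<phi>" p] M[OF pS] M[of "P \<phi>"] PT
              by (simp add: T_def)
          qed simp
          finally show False using h by simp
        qed
      qed
    qed
  qed
  moreover have "P \<theta> = p" using P[of \<theta>] p by (simp add: u_def)
  ultimately have "((\<lambda>\<phi>. (\<i> * (cis \<phi> * u0)) \<bullet> P \<phi>) \<longlongrightarrow> (\<i> * (cis \<theta> * u0)) \<bullet> P \<theta>) (at \<theta>)"
    by (auto intro!: tendsto_intros)
  then show ?thesis by (simp add: isCont_def offset_def P_def)
qed

section \<open>Integrability, and \<open>pdist\<close> as an integral of offsets\<close>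

lemma borel_measurable_offset:
  assumes "norm u0 = 1" "compact S" "S \<noteq> {}"
  shows "(\<lambda>\<theta>. offset (cis \<theta> * u0) S) \<in> borel_measurable borel"
proof -
  obtain M where M: "\<And>x. x \<in> S \<Longrightarrow> norm x \<le> M" using compact_norm_bound[OF assms(2)] by blast
  have [measurable]: "(\<lambda>\<theta>. 2 * M * \<theta> - offset (cis \<theta> * u0) S) \<in> borel_measurable borel"
    by (rule borel_measurable_mono[OF mono_offset[OF assms M]])
  \<comment> \<open>The offset is recovered as a linear function minus a monotone one.\<close>
  have "(\<lambda>\<theta>. 2 * M * \<theta> - (2 * M * \<theta> - offset (cis \<theta> * u0) S)) \<in> borel_measurable borel"
    by measurable
  then show ?thesis by simp
qed

lemma abs_offset_le:
  assumes "norm u = 1" "compact S" "S \<noteq> {}" "\<And>x. x \<in> S \<Longrightarrow> norm x \<le> M"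
  shows "\<bar>offset u S\<bar> \<le> M"
proof -
  have "(SOME p. p \<in> face u S) \<in> S" using face_some[OF assms(2,3), of u] by (simp add: face_def)
  then have "norm (SOME p. p \<in> face u S) \<le> M" by (rule assms(4))
  then show ?thesis
    using Cauchy_Schwarz_ineq2[of "\<i> * u" "SOME p. p \<in> face u S"] assms(1)
    by (simp add: offset_def norm_mult)
qed

lemma integrable_abs_offset_diff:
  assumes "norm u0 = 1" "compact S" "S \<noteq> {}" "compact T" "T \<noteq> {}"
  shows "(\<lambda>\<theta>. \<bar>offset (cis \<theta> * u0) S - offset (cis \<theta> * u0) T\<bar>) integrable_on {a..b}"
proof -
  obtain M where M: "\<And>x. x \<in> S \<Longrightarrow> norm x \<le> M" using compact_norm_bound[OF assms(2)] by blast
  obtain N where N: "\<And>x. x \<in> T \<Longrightarrow> norm x \<le> N" using compact_norm_bound[OF assms(4)] by blast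
  note [measurable] = borel_measurable_offset[OF assms(1-3)] borel_measurable_offset[OF assms(1,4,5)]
  have "(\<lambda>\<theta>. \<bar>offset (cis \<theta> * u0) S - offset (cis \<theta> * u0) T\<bar>) \<in> borel_measurable lborel"
    by measurable
  then have "(\<lambda>\<theta>. \<bar>offset (cis \<theta> * u0) S - offset (cis \<theta> * u0) T\<bar>)
      \<in> borel_measurable (lebesgue_on {a..b})"
    by (intro measurable_restrict_space1 measurable_completion)
  moreover have "\<bar>offset (cis \<theta> * u0) S - offset (cis \<theta> * u0) T\<bar> \<le> M + N" for \<theta>
    using abs_offset_le[OF _ assms(2,3) M, of "cis \<theta> * u0"]
      abs_offset_le[OF _ assms(4,5) N, of "cis \<theta> * u0"] assms(1)
    by (auto simp: norm_mult)
  ultimately show ?thesis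
    by - (rule measurable_bounded_by_integrable_imp_integrable[where g = "\<lambda>_. M + N"], auto)
qed

lemma negligible_not_normal_line_defined:
  assumes "norm u0 = 1" "compact S" "S \<noteq> {}"
  shows "negligible {\<theta>. \<not> normal_line_defined u0 \<theta> S}"
  using countable_imp_null_set_lborel[OF countable_not_normal_line_defined[OF assms]]
  by (simp add: negligible_iff_null_sets null_sets_completionI)

lemma pdist_eq_integral_offset:
  assumes "norm u0 = 1" "compact S" "S \<noteq> {}" "compact T" "T \<noteq> {}"
  shows "pdist u0 S T =
    1 / 2 * integral {0..2 * pi} (\<lambda>\<theta>. \<bar>offset (cis \<theta> * u0) S - offset (cis \<theta> * u0) T\<bar>)"
proof -
  \<comment> \<open>Off this null set both normal lines are level sets of one unit functional, so
    their distance is the difference of their levels.\<close>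
  have "negligible ({\<theta>. \<not> normal_line_defined u0 \<theta> S} \<union> {\<theta>. \<not> normal_line_defined u0 \<theta> T})"
    using assms by (intro negligible_Un negligible_not_normal_line_defined)
  then have "integral {0..2 * pi} (\<lambda>\<theta>. setdist (normal_line u0 \<theta> S) (normal_line u0 \<theta> T)) =
      integral {0..2 * pi} (\<lambda>\<theta>. \<bar>offset (cis \<theta> * u0) S - offset (cis \<theta> * u0) T\<bar>)"
  proof (rule integral_spike)
    fix \<theta>
    assume "\<theta> \<in> {0..2 * pi} -
      ({\<theta>. \<not> normal_line_defined u0 \<theta> S} \<union> {\<theta>. \<not> normal_line_defined u0 \<theta> T})"
    then have d: "normal_line_defined u0 \<theta> S" "normal_line_defined u0 \<theta> T" by auto
    show "\<bar>offset (cis \<theta> * u0) S - offset (cis \<theta> * u0) T\<bar> =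
        setdist (normal_line u0 \<theta> S) (normal_line u0 \<theta> T)"
      unfolding normal_line_eq[OF assms(1-3) d(1)] normal_line_eq[OF assms(1,4,5) d(2)]
      by (subst setdist_parallel_lines) (use assms(1) in \<open>auto simp: norm_mult\<close>)
  qed
  then show ?thesis by (simp add: pdist_def)
qed

section \<open>Convex curves, their bodies and Minkowski combinations\<close>

lemma convex_body_nonempty: "convex_body K \<Longrightarrow> K \<noteq> {}"
  unfolding convex_body_def by auto

lemma compact_frontier_nonempty:
  fixes K :: "complex set"
  assumes "compact K" "K \<noteq> {}"
  shows "compact (frontier K)" "frontier K \<noteq> {}"
proof -
  show "compact (frontier K)" using assms(1) by (rule compact_frontier)
  show "frontier K \<noteq> {}"
    using assms compact_imp_bounded not_bounded_UNIV by (auto simp: frontier_eq_empty)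
qed

lemma convex_curve_compact_nonempty:
  assumes "convex_curve C"
  shows "compact C" "C \<noteq> {}"
proof -
  obtain K where "convex_body K" "C = frontier K" using assms by (auto simp: convex_curve_def)
  then show "compact C" "C \<noteq> {}"
    using compact_frontier_nonempty[of K] convex_body_nonempty[of K]
    by (auto simp: convex_body_def)
qed

lemma curve_body:
  assumes "convex_curve C"
  shows "convex_body (curve_body C)" "frontier (curve_body C) = C"
proof -
  obtain K where K: "convex_body K" "frontier K = C"
    using assms by (auto simp: convex_curve_def)
  \<comment> \<open>A compact convex set is the convex hull of its frontier, so the curve determines
    its body and the definite description is meaningful.\<close>
  have "L = K" if "convex_body L \<and> frontier L = C" for L
    using Krein_Milman_frontier[of L] Krein_Milman_frontier[of K] that K
    by (simp add: convex_body_def)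
  then have "convex_body (curve_body C) \<and> frontier (curve_body C) = C"
    unfolding curve_body_def by (rule theI[of _ K, rotated]) (use K in auto)
  then show "convex_body (curve_body C)" "frontier (curve_body C) = C" by auto
qed

lemma minkowski_comb_compact_nonempty:
  fixes t :: real
  assumes "convex_curve C1" "convex_curve C2"
  defines "B \<equiv> {t *\<^sub>R x + (1 - t) *\<^sub>R y |x y. x \<in> curve_body C1 \<and> y \<in> curve_body C2}"
  shows "compact B" "B \<noteq> {}"
proof -
  have K: "compact (curve_body C1)" "curve_body C1 \<noteq> {}"
    "compact (curve_body C2)" "curve_body C2 \<noteq> {}"
    using curve_body[OF assms(1)] curve_body[OF assms(2)] convex_body_nonempty
    by (auto simp: convex_body_def)
  have "B = {x + y |x y. x \<in> (*\<^sub>R) t ` curve_body C1 \<and> y \<in> (*\<^sub>R) (1 - t) ` curve_body C2}"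
    unfolding B_def by blast
  then show "compact B" using K by (simp add: compact_sums compact_scaling)
  show "B \<noteq> {}" using K unfolding B_def by blast
qed

lemma minkowski_comb_frontier_compact_nonempty:
  assumes "convex_curve C1" "convex_curve C2"
  shows "compact (minkowski_comb t C1 C2)" "minkowski_comb t C1 C2 \<noteq> {}"
  unfolding minkowski_comb_def
  using compact_frontier_nonempty[OF minkowski_comb_compact_nonempty[OF assms]] by auto

text \<open>Combining extremal points of the two bodies gives an extremal point of the combination.
  It need not be the one chosen by \<open>offset\<close>, but uniqueness of the normal line forces
  the two offsets to agree.\<close>

lemma offset_minkowski_comb:
  assumes "norm u0 = 1" "convex_curve C1" "convex_curve C2" "0 \<le> t" "t \<le> 1"
    and "normal_line_defined u0 \<theta> (minkowski_comb t C1 C2)"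
  shows "offset (cis \<theta> * u0) (minkowski_comb t C1 C2) =
    t * offset (cis \<theta> * u0) C1 + (1 - t) * offset (cis \<theta> * u0) C2"
proof -
  define u where "u = cis \<theta> * u0"
  have u: "u \<noteq> 0" using assms(1) by (auto simp: u_def)
  have face: "face u C = face u (curve_body C)" if "convex_curve C" for C
    using face_frontier[of "curve_body C" u] curve_body[OF that] convex_body_nonempty u
    by (simp add: convex_body_def)
  define p q where "p = (SOME p. p \<in> face u C1)" and "q = (SOME p. p \<in> face u C2)"
  have "p \<in> face u (curve_body C1)" "q \<in> face u (curve_body C2)"
    unfolding p_def q_def using face[OF assms(2)] face[OF assms(3)]
      face_some[OF convex_curve_compact_nonempty[OF assms(2)], of u]
      face_some[OF convex_curve_compact_nonempty[OF assms(3)], of u] by auto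
  then have "t *\<^sub>R p + (1 - t) *\<^sub>R q \<in> face u (minkowski_comb t C1 C2)"
    unfolding minkowski_comb_def
      face_frontier[OF minkowski_comb_compact_nonempty[OF assms(2,3)] u]
    by (rule face_minkowski) (use assms in auto)
  with assms(6) have "(\<i> * u) \<bullet> (t *\<^sub>R p + (1 - t) *\<^sub>R q) = offset u (minkowski_comb t C1 C2)"
    unfolding normal_line_defined_iff[OF assms(1) minkowski_comb_frontier_compact_nonempty[OF assms(2,3)]]
    by (simp add: u_def)
  then show ?thesis
    by (simp add: inner_add_right offset_def u_def p_def q_def)
qed

text \<open>Replaces the offset of the combination by the combination of offsets under the integral;
  the two differ at most on a null set, which also transfers integrability to
  \<open>f\<close>.\<close>

lemma pdist_minkowski_comb:
  assumes "norm u0 = 1" "convex_curve C1" "convex_curve C2" "convex_curve D" "0 \<le> t" "t \<le> 1"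
  defines "w \<equiv> \<lambda>C \<theta>. offset (cis \<theta> * u0) C"
  defines "f \<equiv> \<lambda>\<theta>. \<bar>t * w C1 \<theta> + (1 - t) * w C2 \<theta> - w D \<theta>\<bar>"
  shows "f integrable_on {0..2 * pi}"
    and "pdist u0 (minkowski_comb t C1 C2) D = 1 / 2 * integral {0..2 * pi} f"
proof -
  note m = minkowski_comb_frontier_compact_nonempty[OF assms(2,3), of t]
  note D = convex_curve_compact_nonempty[OF assms(4)]
  have N: "negligible {\<theta>. \<not> normal_line_defined u0 \<theta> (minkowski_comb t C1 C2)}"
    by (rule negligible_not_normal_line_defined[OF assms(1) m])
  have eq: "f \<theta> = \<bar>w (minkowski_comb t C1 C2) \<theta> - w D \<theta>\<bar>"
    if "\<theta> \<in> {0..2 * pi} - {\<theta>. \<not> normal_line_defined u0 \<theta> (minkowski_comb t C1 C2)}" for \<theta>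
    using offset_minkowski_comb[OF assms(1-3,5,6), of \<theta>] that by (simp add: w_def f_def)
  show "f integrable_on {0..2 * pi}"
    by (rule integrable_spike[OF integrable_abs_offset_diff[OF assms(1) m D] N])
      (use eq in \<open>auto simp: w_def\<close>)
  have "integral {0..2 * pi} (\<lambda>\<theta>. \<bar>w (minkowski_comb t C1 C2) \<theta> - w D \<theta>\<bar>) = integral {0..2 * pi} f"
    by (rule integral_spike[OF N]) (rule eq)
  then show "pdist u0 (minkowski_comb t C1 C2) D = 1 / 2 * integral {0..2 * pi} f"
    unfolding pdist_eq_integral_offset[OF assms(1) m D] by (simp add: w_def)
qed

section \<open>Tools for the equality case\<close>

lemma continuous_nonneg_integral_0_imp_0:
  fixes g :: "real \<Rightarrow> real"
  assumes "g integrable_on {a..b}" "integral {a..b} g = 0" "\<And>x. 0 \<le> g x"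
    and "a < b" "c \<in> {a..b}" "isCont g c"
  shows "g c = 0"
proof (rule ccontr)
  assume "g c \<noteq> 0"
  then have pos: "g c > 0" using assms(3)[of c] by simp
  obtain e where e: "e > 0" "\<And>x. dist x c < e \<Longrightarrow> dist (g x) (g c) < g c / 2"
    using assms(6) pos unfolding continuous_at_eps_delta by (metis half_gt_zero)
  \<comment> \<open>Clipping to the domain leaves an interval of positive length even when
    \<open>c\<close> is an endpoint. There \<open>g\<close> stays above half of \<open>g c\<close>,
    so its integral would be positive.\<close>
  define l r where "l = max a (c - e / 2)" and "r = min b (c + e / 2)"
  have lr: "l < r" "{l..r} \<subseteq> {a..b}" using assms e by (auto simp: l_def r_def)
  have i: "g integrable_on {l..r}" by (rule integrable_on_subinterval[OF assms(1) lr(2)])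
  have "g c / 2 \<le> g x" if "x \<in> {l..r}" for x
  proof -
    have "\<bar>x - c\<bar> < e" using that e(1) by (auto simp: l_def r_def abs_less_iff)
    then show ?thesis using e(2)[of x] unfolding dist_real_def by linarith
  qed
  then have "integral {l..r} (\<lambda>_. g c / 2) \<le> integral {l..r} g"
    using i by (intro integral_le) auto
  also have "\<dots> \<le> integral {a..b} g" using assms i lr by (intro integral_subset_le) auto
  finally have "(r - l) * (g c / 2) \<le> 0" using lr assms(2) by simp
  then show False using pos lr by (simp add: mult_le_0_iff)
qed

text \<open>The three lines contain the multiples \<open>d *\<^sub>R v\<close>,
  \<open>c1 *\<^sub>R v\<close> and \<open>c2 *\<^sub>R v\<close> of their common unit normal.
  Evaluating the separating functional \<open>a\<close> at these puts \<open>c1\<close> and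
  \<open>c2\<close> strictly on opposite sides of \<open>d\<close>.\<close>

lemma separated_by_line_level_sets:
  fixes u :: complex
  assumes "norm u = 1"
    and "separated_by_line {x. (\<i> * u) \<bullet> x = d} {x. (\<i> * u) \<bullet> x = c1} {x. (\<i> * u) \<bullet> x = c2}"
  shows "(c1 - d) * (c2 - d) < 0"
proof -
  define v where "v = \<i> * u"
  obtain a c where ac: "{x. v \<bullet> x = d} = {x. a \<bullet> x = c}"
    "{x. v \<bullet> x = c1} \<subseteq> {x. a \<bullet> x < c}" "{x. v \<bullet> x = c2} \<subseteq> {x. c < a \<bullet> x}"
    using assms(2) unfolding separated_by_line_def v_def by blast
  have vv: "v \<bullet> v = 1" using assms by (simp add: v_def norm_mult flip: norm_eq_1)
  have "d *\<^sub>R v \<in> {x. v \<bullet> x = d}" using vv by simp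
  then have d: "d * (a \<bullet> v) = c" unfolding ac by simp
  have c1: "c1 * (a \<bullet> v) < c" using ac(2) vv by (auto dest!: subsetD[where c = "c1 *\<^sub>R v"])
  have c2: "c2 * (a \<bullet> v) > c" using ac(3) vv by (auto dest!: subsetD[where c = "c2 *\<^sub>R v"])
  have "(c1 - d) * (a \<bullet> v) < 0" "(c2 - d) * (a \<bullet> v) > 0"
    unfolding left_diff_distrib d using c1 c2 by linarith+
  then have "((c1 - d) * (a \<bullet> v)) * ((c2 - d) * (a \<bullet> v)) < 0"
    by (rule mult_neg_pos)
  then have "((c1 - d) * (c2 - d)) * (a \<bullet> v)\<^sup>2 < 0" by (simp add: power2_eq_square ac_simps)
  then show ?thesis by (simp add: mult_less_0_iff)
qed

text \<open>The two weighted terms have strictly opposite signs, so they partly cancel.\<close>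

lemma abs_convex_comb_less:
  fixes x y t :: real
  assumes "x * y < 0" "0 < t" "t < 1"
  shows "\<bar>t * x + (1 - t) * y\<bar> < t * \<bar>x\<bar> + (1 - t) * \<bar>y\<bar>"
proof -
  have "t * x > 0 \<and> (1 - t) * y < 0 \<or> t * x < 0 \<and> (1 - t) * y > 0"
    using assms by (auto simp: mult_less_0_iff zero_less_mult_iff)
  moreover have "t * \<bar>x\<bar> = \<bar>t * x\<bar>" "(1 - t) * \<bar>y\<bar> = \<bar>(1 - t) * y\<bar>"
    using assms by (auto simp: abs_mult)
  ultimately show ?thesis by linarith
qed

theorem proposition2p3:
  fixes u0 :: complex
  assumes "norm u0 = 1"
  shows
    "(\<forall>C1 C2. convex_curve C1 \<longrightarrow> convex_curve C2 \<longrightarrow> pdist u0 C1 C2 \<ge> 0) \<and>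
     (\<forall>C1. convex_curve C1 \<longrightarrow> pdist u0 C1 C1 = 0) \<and>
     (\<forall>C1 C2. convex_curve C1 \<longrightarrow> convex_curve C2 \<longrightarrow> pdist u0 C1 C2 = pdist u0 C2 C1) \<and>
     (\<forall>C1 C2 C3. convex_curve C1 \<longrightarrow> convex_curve C2 \<longrightarrow> convex_curve C3 \<longrightarrow>
        pdist u0 C1 C3 \<le> pdist u0 C1 C2 + pdist u0 C2 C3) \<and>
     (\<forall>C1 C2 D. convex_curve C1 \<longrightarrow> convex_curve C2 \<longrightarrow> convex_curve D \<longrightarrow>
        (\<forall>t\<in>{0..1}. pdist u0 (minkowski_comb t C1 C2) D
                      \<le> t * pdist u0 C1 D + (1 - t) * pdist u0 C2 D) \<and>
        ((\<exists>t\<in>{0<..<1}. pdist u0 (minkowski_comb t C1 C2) D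
                         = t * pdist u0 C1 D + (1 - t) * pdist u0 C2 D) \<longrightarrow>
         (\<forall>\<theta>\<in>{0..2 * pi}.
            normal_line_defined u0 \<theta> C1 \<longrightarrow> normal_line_defined u0 \<theta> C2 \<longrightarrow>
            normal_line_defined u0 \<theta> D \<longrightarrow>
            same_side (normal_line u0 \<theta> D) (normal_line u0 \<theta> C1) (normal_line u0 \<theta> C2))))"
proof (intro conjI allI impI ballI)
  note cc = convex_curve_compact_nonempty
  note eq = pdist_eq_integral_offset[OF assms]
  note int = integrable_abs_offset_diff[OF assms]
  define w where "w C \<theta> = offset (cis \<theta> * u0) C" for C \<theta>
  show "pdist u0 C1 C1 = 0" for C1
    by (simp add: pdist_def setdist_refl)
  show "pdist u0 C1 C2 = pdist u0 C2 C1" for C1 C2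
    by (simp add: pdist_def setdist_sym)
  show "0 \<le> pdist u0 C1 C2" if "convex_curve C1" "convex_curve C2" for C1 C2
    unfolding eq[OF cc[OF that(1)] cc[OF that(2)]]
    using integral_nonneg[OF int[OF cc[OF that(1)] cc[OF that(2)]], of 0 "2 * pi"] by simp
  show "pdist u0 C1 C3 \<le> pdist u0 C1 C2 + pdist u0 C2 C3"
    if "convex_curve C1" "convex_curve C2" "convex_curve C3" for C1 C2 C3
  proof -
    note i = int[OF cc[OF that(1)] cc[OF that(3)], of 0 "2 * pi"]
      int[OF cc[OF that(1)] cc[OF that(2)], of 0 "2 * pi"]
      int[OF cc[OF that(2)] cc[OF that(3)], of 0 "2 * pi"]
    have "integral {0..2 * pi} (\<lambda>\<theta>. \<bar>w C1 \<theta> - w C3 \<theta>\<bar>) \<le>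
        integral {0..2 * pi} (\<lambda>\<theta>. \<bar>w C1 \<theta> - w C2 \<theta>\<bar> + \<bar>w C2 \<theta> - w C3 \<theta>\<bar>)"
      using i unfolding w_def[symmetric] by (intro integral_le integrable_add) auto
    also have "\<dots> = integral {0..2 * pi} (\<lambda>\<theta>. \<bar>w C1 \<theta> - w C2 \<theta>\<bar>) +
        integral {0..2 * pi} (\<lambda>\<theta>. \<bar>w C2 \<theta> - w C3 \<theta>\<bar>)"
      using i unfolding w_def[symmetric] by (intro integral_add) auto
    finally show ?thesis
      unfolding eq[OF cc[OF that(1)] cc[OF that(2)]] eq[OF cc[OF that(1)] cc[OF that(3)]]
        eq[OF cc[OF that(2)] cc[OF that(3)]] by (simp add: w_def)
  qed
  fix C1 C2 D assume C: "convex_curve C1" "convex_curve C2" "convex_curve D"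
  \<comment> \<open>The pointwise convexity defect. It uses the combination of the offsets of
    \<open>C1\<close> and \<open>C2\<close> rather than the offset of the Minkowski combination, so
    its continuity at an angle depends only on the normal lines of \<open>C1\<close>,
    \<open>C2\<close> and \<open>D\<close>.\<close>
  define g where "g t \<theta> = t * \<bar>w C1 \<theta> - w D \<theta>\<bar> + (1 - t) * \<bar>w C2 \<theta> - w D \<theta>\<bar>
    - \<bar>t * w C1 \<theta> + (1 - t) * w C2 \<theta> - w D \<theta>\<bar>" for t \<theta>
  have split: "t * w C1 \<theta> + (1 - t) * w C2 \<theta> - w D \<theta> =
      t * (w C1 \<theta> - w D \<theta>) + (1 - t) * (w C2 \<theta> - w D \<theta>)" for t \<theta>
    by (simp add: algebra_simps)
  have g_nonneg: "0 \<le> g t \<theta>" if "0 \<le> t" "t \<le> 1" for t \<theta>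
    unfolding g_def split
    using abs_triangle_ineq[of "t * (w C1 \<theta> - w D \<theta>)" "(1 - t) * (w C2 \<theta> - w D \<theta>)"] that
    by (simp add: abs_mult)
  \<comment> \<open>Half the integral of \<open>g t\<close> is exactly the slack in the convexity
    inequality, so both that inequality and its equality case are read off from
    \<open>g t\<close>.\<close>
  have g_int: "g t integrable_on {0..2 * pi}"
    and g_pdist: "1 / 2 * integral {0..2 * pi} (g t) =
      t * pdist u0 C1 D + (1 - t) * pdist u0 C2 D - pdist u0 (minkowski_comb t C1 C2) D"
    if t: "0 \<le> t" "t \<le> 1" for t
  proof -
    note i = int[OF cc[OF C(1)] cc[OF C(3)], of 0 "2 * pi", folded w_def]
      int[OF cc[OF C(2)] cc[OF C(3)], of 0 "2 * pi", folded w_def]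
    note m = pdist_minkowski_comb[OF assms C t, folded w_def]
    note s = integrable_on_mult_right[OF i(1), of t] integrable_on_mult_right[OF i(2), of "1 - t"]
    show "g t integrable_on {0..2 * pi}"
      unfolding g_def by (intro integrable_diff integrable_add s m)
    have "integral {0..2 * pi} (g t) =
        t * integral {0..2 * pi} (\<lambda>\<theta>. \<bar>w C1 \<theta> - w D \<theta>\<bar>)
        + (1 - t) * integral {0..2 * pi} (\<lambda>\<theta>. \<bar>w C2 \<theta> - w D \<theta>\<bar>)
        - integral {0..2 * pi} (\<lambda>\<theta>. \<bar>t * w C1 \<theta> + (1 - t) * w C2 \<theta> - w D \<theta>\<bar>)"
      unfolding g_def
      by (subst integral_diff[OF integrable_add[OF s] m(1)], subst integral_add[OF s]) simp
    moreover have "1 / 2 * (t * x + (1 - t) * y - z) =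
        t * (1 / 2 * x) + (1 - t) * (1 / 2 * y) - 1 / 2 * z" for x y z :: real
      by (simp add: field_simps)
    ultimately show "1 / 2 * integral {0..2 * pi} (g t) =
        t * pdist u0 C1 D + (1 - t) * pdist u0 C2 D - pdist u0 (minkowski_comb t C1 C2) D"
      unfolding m(2) eq[OF cc[OF C(1)] cc[OF C(3)], folded w_def]
        eq[OF cc[OF C(2)] cc[OF C(3)], folded w_def]
      by (simp only:)
  qed
  show "pdist u0 (minkowski_comb t C1 C2) D \<le> t * pdist u0 C1 D + (1 - t) * pdist u0 C2 D"
    if "t \<in> {0..1}" for t
    using g_pdist[of t] integral_nonneg[OF g_int, of t] g_nonneg[of t] that by auto
  fix \<theta> assume *: "\<exists>t\<in>{0<..<1}. pdist u0 (minkowski_comb t C1 C2) D =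
      t * pdist u0 C1 D + (1 - t) * pdist u0 C2 D"
    and \<theta>: "\<theta> \<in> {0..2 * pi}"
    and def: "normal_line_defined u0 \<theta> C1" "normal_line_defined u0 \<theta> C2"
      "normal_line_defined u0 \<theta> D"
  from * obtain t where t: "0 < t" "t < 1"
    and teq: "pdist u0 (minkowski_comb t C1 C2) D = t * pdist u0 C1 D + (1 - t) * pdist u0 C2 D"
    by auto
  have "isCont (w C1) \<theta>" "isCont (w C2) \<theta>" "isCont (w D) \<theta>"
    using isCont_offset[OF assms cc[OF C(1)] def(1)] isCont_offset[OF assms cc[OF C(2)] def(2)]
      isCont_offset[OF assms cc[OF C(3)] def(3)] by (auto simp: w_def[abs_def])
  then have "isCont (g t) \<theta>" unfolding g_def by (intro continuous_intros) auto
  moreover have "integral {0..2 * pi} (g t) = 0" using g_pdist[of t] t teq by simp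
  ultimately have g0: "g t \<theta> = 0"
    using continuous_nonneg_integral_0_imp_0[OF g_int _ g_nonneg _ \<theta>, of t] t by simp
  show "same_side (normal_line u0 \<theta> D) (normal_line u0 \<theta> C1) (normal_line u0 \<theta> C2)"
    unfolding same_side_def
  proof
    \<comment> \<open>Separated lines would have offsets strictly on opposite sides of that of
      \<open>D\<close>, making the triangle inequality strict and \<open>g t \<theta>\<close>
      positive.\<close>
    assume "separated_by_line (normal_line u0 \<theta> D) (normal_line u0 \<theta> C1) (normal_line u0 \<theta> C2)"
    then have "(w C1 \<theta> - w D \<theta>) * (w C2 \<theta> - w D \<theta>) < 0"
      unfolding normal_line_eq[OF assms cc[OF C(1)] def(1)]
        normal_line_eq[OF assms cc[OF C(2)] def(2)]
        normal_line_eq[OF assms cc[OF C(3)] def(3)] w_def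
      using assms by (intro separated_by_line_level_sets[of "cis \<theta> * u0"]) (auto simp: norm_mult)
    from abs_convex_comb_less[OF this t] g0 show False
      unfolding g_def split by simp
  qed
qed

end
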